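(* Let $$B(t,x,y,z)=\sum_{n\ge 1}\ \sum_{k,\ell,j\ge 0}\bigl|\{\pi\in\mathcal{S}_n(312,4321) : \operatorname{cyc}(\pi)=k,\ \operatorname{exc}(\pi)=\ell,\ \operatorname{inv}(\pi)=j\}\bigr|\,t^kx^\ell y^jz^n,$$ a formal power series in $z$ with coefficients in $\mathbb{Z}[t,x,y]$. Then $$B(t,x,y,z)=\frac{tz(1-x^2y^4z^2)}{1-z(xy+t)-xy^3z^2(t+xy)-x^2y^4z^3(y-t-xy)}.$$
   Context: $\mathcal{S}_n$ is the set of permutations of $[n]=\{1,\dots,n\}$; $\pi\in\mathcal{S}_n$ is written in one-line notation as $\pi=\pi_1\pi_2\cdots\pi_n$ with $\pi_i=\pi(i)$. A permutation $\pi\in\mathcal{S}_n$ contains a pattern $\sigma\in\mathcal{S}_r$ if there are indices $i_1<\dots<i_r$ such that $\pi_{i_1}\cdots\pi_{i_r}$ is in the same relative order as $\sigma$; otherwise $\pi$ avoids $\sigma$. $\mathcal{S}_n(312,4321)$ is the set of $\pi\in\mathcal{S}_n$ avoiding both patterns $312$ and $4321$. $\operatorname{cyc}(\pi)$ is the number of cycles in the disjoint cycle decomposition of $\pi$ (fixed points counted as cycles); $\operatorname{exc}(\pi)$ is the number of $j$ with $\pi_j>j$; $\operatorname{inv}(\pi)$ is the number of pairs $i<j$ with $\pi_i>\pi_j$. *)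

theory Defs
  imports
    "HOL-Combinatorics.Orbits"
    "HOL-Library.Groups_Big_Fun"
    "HOL-Computational_Algebra.Computational_Algebra"
begin

section \<open>Permutations and statistics\<close>

text \<open>
  The elements of \<open>S_n\<close> are the functions \<open>\<pi> :: nat \<Rightarrow> nat\<close> with \<open>\<pi> permutes {1..n}\<close>. Such a
  function is the identity outside \<open>{1..n}\<close>, so it is determined by its values there.
  A pattern is a list in one-line notation. The list is indexed from \<open>0\<close>; the chosen
  positions \<open>i 0 < i 1 < \<dots>\<close> of \<open>\<pi>\<close> lie in \<open>{1..n}\<close>.
\<close>

definition contains_pattern :: "nat \<Rightarrow> (nat \<Rightarrow> nat) \<Rightarrow> nat list \<Rightarrow> bool" where
  "contains_pattern n \<pi> \<sigma> \<longleftrightarrow>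
     (\<exists>i :: nat \<Rightarrow> nat.
        strict_mono_on {..<length \<sigma>} i \<and> i ` {..<length \<sigma>} \<subseteq> {1..n} \<and>
        (\<forall>a<length \<sigma>. \<forall>b<length \<sigma>. \<pi> (i a) < \<pi> (i b) \<longleftrightarrow> \<sigma> ! a < \<sigma> ! b))"

definition avoiders :: "nat \<Rightarrow> nat list set \<Rightarrow> (nat \<Rightarrow> nat) set" where
  "avoiders n \<Sigma> = {\<pi>. \<pi> permutes {1..n} \<and> (\<forall>\<sigma>\<in>\<Sigma>. \<not> contains_pattern n \<pi> \<sigma>)}"

text \<open>
  The cycles of \<open>\<pi>\<close> are counted as orbits, i.e. as supports of cycles; a fixed point \<open>a\<close>
  contributes the orbit \<open>{a}\<close>.
\<close>

definition cyc :: "nat \<Rightarrow> (nat \<Rightarrow> nat) \<Rightarrow> nat" where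
  "cyc n \<pi> = card (orbit \<pi> ` {1..n})"

definition exc :: "nat \<Rightarrow> (nat \<Rightarrow> nat) \<Rightarrow> nat" where
  "exc n \<pi> = card {j \<in> {1..n}. \<pi> j > j}"

definition inv_count :: "nat \<Rightarrow> (nat \<Rightarrow> nat) \<Rightarrow> nat" where
  "inv_count n \<pi> = card {(i, j). i \<in> {1..n} \<and> j \<in> {1..n} \<and> i < j \<and> \<pi> i > \<pi> j}"


section \<open>The generating function\<close>

text \<open>
  The ring \<open>\<int>[t,x,y]\<close> is the iterated polynomial ring \<open>((\<int>[t])[x])[y]\<close>.
\<close>

type_synonym poly_txy = "int poly poly poly"

definition var_t :: poly_txy where "var_t = [:[:[:0, 1:]:]:]"
definition var_x :: poly_txy where "var_x = [:[:0, 1:]:]"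
definition var_y :: poly_txy where "var_y = [:0, 1:]"

definition num_avoiders :: "nat \<Rightarrow> nat \<Rightarrow> nat \<Rightarrow> nat \<Rightarrow> nat" where
  "num_avoiders n k l j =
     card {\<pi> \<in> avoiders n {[3,1,2], [4,3,2,1]}. cyc n \<pi> = k \<and> exc n \<pi> = l \<and> inv_count n \<pi> = j}"

text \<open>
  \<^const>\<open>Sum_any\<close> sums over all triples of natural numbers; by the lemma
  \<open>finite_support_num_avoiders\<close> below only finitely many summands are nonzero.
\<close>

definition B_gf :: "poly_txy fps" where
  "B_gf = Abs_fps (\<lambda>n. if n \<ge> 1
     then Sum_any (\<lambda>(k, l, j). of_nat (num_avoiders n k l j) * var_t ^ k * var_x ^ l * var_y ^ j)
     else 0)"

text \<open>
  Division of power series in the library needs an inverse on the coefficients, which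
  \<^typ>\<open>poly_txy\<close> does not have. Quotients of elements of \<open>\<int>[t,x,y][[z]]\<close>, an integral domain,
  are therefore taken in its fraction field, via the injective map \<^const>\<open>to_fract\<close>.
\<close>

lemma finite_avoiders: "finite (avoiders n \<Sigma>)"
  by (rule finite_subset[OF _ finite_permutations[of "{1..n}"]]) (auto simp: avoiders_def)

lemma finite_support_num_avoiders: "finite {(k, l, j). num_avoiders n k l j \<noteq> 0}"
proof (rule finite_subset)
  show "{(k, l, j). num_avoiders n k l j \<noteq> 0} \<subseteq>
      (\<lambda>\<pi>. (cyc n \<pi>, exc n \<pi>, inv_count n \<pi>)) ` avoiders n {[3,1,2], [4,3,2,1]}"
    by (auto simp: num_avoiders_def card_eq_0_iff)
  show "finite \<dots>"
    by (intro finite_imageI finite_avoiders)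
qed

end

theory Submission
  imports Defs
begin

text \<open>
  A permutation is recovered from its first entry \<open>c + 1\<close> and the standardisation \<open>\<pi>\<close> of the remaining
  word, and \<open>c\<close> counts the inversions of the first entry. The word avoids both patterns iff \<open>\<pi>\<close> does,
  \<open>c \<le> 2\<close> and \<open>c \<le> \<pi> 1\<close>. For \<open>c = 0\<close> a fixed point is added; for \<open>c = 1\<close> the edge of \<open>\<pi>\<close> into \<open>1\<close>
  is subdivided. A single step with \<open>c = 2\<close> alters the cycles in an uncontrolled way, but \<open>\<pi>\<close> then
  starts with \<open>2\<close> or \<open>3\<close>, and two steps together are harmless: a word beginning \<open>3 2\<close> subdivides the
  edge into \<open>1\<close> and adds the fixed point \<open>2\<close>, a word beginning \<open>3 4\<close> subdivides the edges into \<open>1\<close>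
  and \<open>2\<close>. In the last case the number of excedances grows by \<open>1\<close> or \<open>2\<close>, according to whether the
  remaining word begins with \<open>2\<close> or \<open>3\<close>. This yields linear equations for the generating functions
  by first entry, from which the one of all avoiders is obtained by elimination.
\<close>

section \<open>Prepending an entry\<close>

text \<open>
  The new word is \<open>c + 1\<close> followed by the word of \<open>\<pi>\<close> with the values above \<open>c\<close> raised by one; the
  value at \<open>0\<close> only serves to make \<open>prepend c \<pi>\<close> the identity outside \<open>{1..Suc n}\<close>.
\<close>

definition prepend :: "nat \<Rightarrow> (nat \<Rightarrow> nat) \<Rightarrow> nat \<Rightarrow> nat" where
  "prepend c \<pi> i = (if i = 0 then 0 else if i = 1 then Suc c
     else if \<pi> (i - 1) \<le> c then \<pi> (i - 1) else Suc (\<pi> (i - 1)))"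

lemma prepend_1 [simp]: "prepend c \<pi> (Suc 0) = Suc c"
  and prepend_Suc: "i > 0 \<Longrightarrow> prepend c \<pi> (Suc i) = (if \<pi> i \<le> c then \<pi> i else Suc (\<pi> i))"
  by (auto simp: prepend_def)

lemma permutes_range:
  assumes "\<pi> permutes {1..n}" "i \<in> {1..n::nat}"
  shows "\<pi> i \<in> {1..n}"
  using assms by (simp only: permutes_in_image)

text \<open>Raising the values above \<open>c\<close> leaves exactly \<open>Suc c\<close> free, and
  the first entry takes it; an injective self-map of a finite interval is onto.\<close>

lemma prepend_permutes:
  assumes p: "\<pi> permutes {1..n}" and c: "c \<le> n"
  shows "prepend c \<pi> permutes {1..Suc n}"
proof (rule bij_imp_permutes)
  have "inj_on (prepend c \<pi>) {1..Suc n}"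
  proof (rule inj_onI)
    fix i j assume i: "i \<in> {1..Suc n}" and j: "j \<in> {1..Suc n}" and e: "prepend c \<pi> i = prepend c \<pi> j"
    have "\<pi> (i - 1) = \<pi> (j - 1)" if "i \<noteq> 1" "j \<noteq> 1"
      using that e i j by (auto simp: prepend_def split: if_splits)
    moreover have "i - 1 = j - 1" if "\<pi> (i - 1) = \<pi> (j - 1)"
      using permutes_inj[OF p] that by (simp add: inj_eq)
    ultimately show "i = j"
      using e i j by (auto simp: prepend_def split: if_splits)
  qed
  moreover have "prepend c \<pi> ` {1..Suc n} \<subseteq> {1..Suc n}"
  proof
    fix v assume "v \<in> prepend c \<pi> ` {1..Suc n}"
    then obtain i where i: "i \<in> {1..Suc n}" "v = prepend c \<pi> i" by auto
    have "\<pi> (i - 1) \<in> {1..n}" if "i \<noteq> 1"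
      using that i(1) by (intro permutes_range[OF p]) auto
    then show "v \<in> {1..Suc n}"
      using i c by (auto simp: prepend_def)
  qed
  ultimately show "bij_betw (prepend c \<pi>) {1..Suc n} {1..Suc n}"
    by (simp add: bij_betw_def endo_inj_surj)
next
  fix i assume i: "i \<notin> {1..Suc n}"
  have "\<pi> (i - 1) = i - 1" if "i \<noteq> 0"
    using that i by (intro permutes_not_in[OF p]) auto
  then show "prepend c \<pi> i = i"
    using i c by (auto simp: prepend_def)
qed

lemma prepend_inject:
  assumes "\<pi> permutes {1..n}" "\<sigma> permutes {1..n}" "prepend c \<pi> = prepend d \<sigma>"
  shows "c = d \<and> \<pi> = \<sigma>"
proof
  show c: "c = d"
    using fun_cong[OF assms(3), of 1] by simp
  show "\<pi> = \<sigma>"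
  proof
    fix i
    show "\<pi> i = \<sigma> i"
    proof (cases "i = 0")
      case True
      then show ?thesis using assms(1,2)[THEN permutes_not_in] by simp
    next
      case False
      then show ?thesis
        using fun_cong[OF assms(3), of "Suc i"] c by (auto simp: prepend_Suc split: if_splits)
    qed
  qed
qed

text \<open>Surjectivity comes from counting, \<open>(n + 1) n! = (n + 1)!\<close>, instead of an
  explicit standardisation map.\<close>

lemma permutes_Suc_obtains_prepend:
  assumes "\<pi> permutes {1..Suc n}"
  obtains c \<sigma> where "c \<le> n" "\<sigma> permutes {1..n}" "\<pi> = prepend c \<sigma>"
proof -
  define P where "P = {..n} \<times> {\<sigma>. \<sigma> permutes {1..n}}"
  have inj: "inj_on (\<lambda>(c, \<sigma>). prepend c \<sigma>) P"
  proof (rule inj_onI)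
    fix a b assume ab: "a \<in> P" "b \<in> P" and "(case a of (c, \<sigma>) \<Rightarrow> prepend c \<sigma>) = (case b of (c, \<sigma>) \<Rightarrow> prepend c \<sigma>)"
    then have "prepend (fst a) (snd a) = prepend (fst b) (snd b)"
      by (simp add: case_prod_unfold)
    then have "fst a = fst b \<and> snd a = snd b"
      by (rule prepend_inject[rotated 2]) (use ab in \<open>auto simp: P_def\<close>)
    then show "a = b"
      by (simp add: prod_eq_iff)
  qed
  have "card ((\<lambda>(c, \<sigma>). prepend c \<sigma>) ` P) = card {\<pi>. \<pi> permutes {1..Suc n}}"
    by (simp add: card_image[OF inj], simp add: P_def card_cartesian_product card_permutations[OF refl])
  moreover have "(\<lambda>(c, \<sigma>). prepend c \<sigma>) ` P \<subseteq> {\<pi>. \<pi> permutes {1..Suc n}}"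
    by (auto simp: P_def intro: prepend_permutes simp del: One_nat_def)
  ultimately have "(\<lambda>(c, \<sigma>). prepend c \<sigma>) ` P = {\<pi>. \<pi> permutes {1..Suc n}}"
    by (intro card_subset_eq finite_permutations) auto
  then have "\<pi> \<in> (\<lambda>(c, \<sigma>). prepend c \<sigma>) ` P"
    using assms by simp
  then show ?thesis
    using that by (auto simp: P_def)
qed

text \<open>Raising the values above \<open>c\<close> is strictly increasing, so patterns among the
  later entries are unaffected.\<close>

lemma prepend_less_iff:
  assumes "i > 0" "j > 0"
  shows "prepend c \<pi> (Suc i) < prepend c \<pi> (Suc j) \<longleftrightarrow> \<pi> i < \<pi> j"
  using assms by (auto simp: prepend_Suc)

section \<open>Avoidance\<close>

lemma all_less_3: "(\<forall>a<3::nat. P a) \<longleftrightarrow> P 0 \<and> P 1 \<and> P 2"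
  and all_less_4: "(\<forall>a<4::nat. P a) \<longleftrightarrow> P 0 \<and> P 1 \<and> P 2 \<and> P 3"
  by (auto simp: eval_nat_numeral less_Suc_eq)

lemma strict_mono_on_lessThan_iff:
  "strict_mono_on {..<n::nat} (i :: nat \<Rightarrow> nat) \<longleftrightarrow> (\<forall>a<n. \<forall>b<n. a < b \<longrightarrow> i a < i b)"
  by (auto simp: strict_mono_on_def)

lemma contains_312_iff:
  "contains_pattern n \<pi> [3,1,2] \<longleftrightarrow>
    (\<exists>i j k. 1 \<le> i \<and> i < j \<and> j < k \<and> k \<le> n \<and> \<pi> j < \<pi> k \<and> \<pi> k < \<pi> i)" (is "?L \<longleftrightarrow> ?R")
proof -
  define Q where "Q i = (strict_mono_on {..<3} i \<and> i ` {..<3} \<subseteq> {1..n} \<and>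
        (\<forall>a<3. \<forall>b<3. \<pi> (i a) < \<pi> (i b) \<longleftrightarrow> [3,1,2::nat] ! a < [3,1,2] ! b))" for i
  have Q: "Q i \<longleftrightarrow> 1 \<le> i 0 \<and> i 0 < i 1 \<and> i 1 < i 2 \<and> i 2 \<le> n \<and> \<pi> (i 1) < \<pi> (i 2) \<and> \<pi> (i 2) < \<pi> (i 0)" for i
    unfolding Q_def strict_mono_on_lessThan_iff image_subset_iff Ball_def lessThan_iff
    unfolding all_less_3 by auto
  have "?L \<longleftrightarrow> (\<exists>i. Q i)"
    by (simp add: contains_pattern_def Q_def numeral_3_eq_3)
  also have "\<dots> \<longleftrightarrow> ?R"
  proof
    assume ?R
    then obtain i j k where "1 \<le> i" "i < j" "j < k" "k \<le> n" "\<pi> j < \<pi> k" "\<pi> k < \<pi> i"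
      by blast
    \<comment> \<open>By the fact \<open>Q\<close>, only the positions at \<open>0\<close>,
      \<open>1\<close>, \<open>2\<close> matter, so list indexing serves as position
      function.\<close>
    then have "Q ((!) [i, j, k])"
      by (simp add: Q)
    then show "\<exists>i. Q i"
      by (rule exI[of Q])
  qed (use Q in blast)
  finally show ?thesis .
qed

lemma contains_4321_iff:
  "contains_pattern n \<pi> [4,3,2,1] \<longleftrightarrow>
    (\<exists>i j k l. 1 \<le> i \<and> i < j \<and> j < k \<and> k < l \<and> l \<le> n \<and> \<pi> j < \<pi> i \<and> \<pi> k < \<pi> j \<and> \<pi> l < \<pi> k)"
    (is "?L \<longleftrightarrow> ?R")
proof -
  define Q where "Q i = (strict_mono_on {..<4} i \<and> i ` {..<4} \<subseteq> {1..n} \<and>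
        (\<forall>a<4. \<forall>b<4. \<pi> (i a) < \<pi> (i b) \<longleftrightarrow> [4,3,2,1::nat] ! a < [4,3,2,1] ! b))" for i
  have Q: "Q i \<longleftrightarrow> 1 \<le> i 0 \<and> i 0 < i 1 \<and> i 1 < i 2 \<and> i 2 < i 3 \<and> i 3 \<le> n \<and>
      \<pi> (i 1) < \<pi> (i 0) \<and> \<pi> (i 2) < \<pi> (i 1) \<and> \<pi> (i 3) < \<pi> (i 2)" for i
    unfolding Q_def strict_mono_on_lessThan_iff image_subset_iff Ball_def lessThan_iff
    unfolding all_less_4 by auto
  have "?L \<longleftrightarrow> (\<exists>i. Q i)"
    by (simp add: contains_pattern_def Q_def eval_nat_numeral)
  also have "\<dots> \<longleftrightarrow> ?R"
  proof
    assume ?R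
    then obtain i j k l where "1 \<le> i" "i < j" "j < k" "k < l" "l \<le> n" "\<pi> j < \<pi> i" "\<pi> k < \<pi> j" "\<pi> l < \<pi> k"
      by blast
    then have "Q ((!) [i, j, k, l])"
      by (simp add: Q)
    then show "\<exists>i. Q i"
      by (rule exI[of Q])
  qed (use Q in blast)
  finally show ?thesis .
qed

abbreviation "Av n \<equiv> avoiders n {[3,1,2], [4,3,2,1]}"

lemma mem_Av_iff:
  "\<pi> \<in> Av n \<longleftrightarrow> \<pi> permutes {1..n} \<and>
    (\<forall>i j k. 1 \<le> i \<and> i < j \<and> j < k \<and> k \<le> n \<longrightarrow> \<not> (\<pi> j < \<pi> k \<and> \<pi> k < \<pi> i)) \<and>
    (\<forall>i j k l. 1 \<le> i \<and> i < j \<and> j < k \<and> k < l \<and> l \<le> n \<longrightarrow>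
      \<not> (\<pi> j < \<pi> i \<and> \<pi> k < \<pi> j \<and> \<pi> l < \<pi> k))"
  unfolding avoiders_def by (simp add: contains_312_iff contains_4321_iff del: One_nat_def) blast

lemma permutes_preimage:
  assumes "\<pi> permutes {1..n}" "1 \<le> v" "v \<le> n"
  obtains i where "1 \<le> i" "i \<le> (n::nat)" "\<pi> i = v"
  using permutes_image[OF assms(1)] assms(2,3)
  by (metis atLeastAtMost_iff imageE)

text \<open>Only occurrences through the new first entry matter. The \<open>c\<close> smaller values
  must decrease, or \<open>312\<close> arises, and at most two can exist, or \<open>4321\<close>
  arises. For \<open>c = 2\<close> the value \<open>2\<close> must precede \<open>1\<close>; as
  \<pi> avoids \<open>312\<close>, this holds exactly when \<pi> does not start with
  \<open>1\<close>.\<close>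

lemma prepend_mem_Av_iff:
  assumes n: "n \<ge> 1" and p: "\<pi> permutes {1..n}" and c: "c \<le> n"
  shows "prepend c \<pi> \<in> Av (Suc n) \<longleftrightarrow> \<pi> \<in> Av n \<and> c \<le> 2 \<and> c \<le> \<pi> 1"
proof
  assume L: "prepend c \<pi> \<in> Av (Suc n)"
  then have A3: "\<not> (prepend c \<pi> j < prepend c \<pi> k \<and> prepend c \<pi> k < prepend c \<pi> i)"
    if "1 \<le> i" "i < j" "j < k" "k \<le> Suc n" for i j k
    using that unfolding mem_Av_iff by blast
  from L have A4: "\<not> (prepend c \<pi> j < prepend c \<pi> i \<and> prepend c \<pi> k < prepend c \<pi> j \<and> prepend c \<pi> l < prepend c \<pi> k)"
    if "1 \<le> i" "i < j" "j < k" "k < l" "l \<le> Suc n" for i j k l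
    using that unfolding mem_Av_iff by blast
  have "\<not> (\<pi> j < \<pi> k \<and> \<pi> k < \<pi> i)" if "1 \<le> i" "i < j" "j < k" "k \<le> n" for i j k
    using that A3[of "Suc i" "Suc j" "Suc k"] by (auto simp: prepend_less_iff)
  moreover have "\<not> (\<pi> j < \<pi> i \<and> \<pi> k < \<pi> j \<and> \<pi> l < \<pi> k)"
    if "1 \<le> i" "i < j" "j < k" "k < l" "l \<le> n" for i j k l
    using that A4[of "Suc i" "Suc j" "Suc k" "Suc l"] by (auto simp: prepend_less_iff)
  ultimately have "\<pi> \<in> Av n"
    using p unfolding mem_Av_iff by blast
  \<comment> \<open>The first entry exceeds all values up to \<open>c\<close>, so an increasing pair
    of them would complete a \<open>312\<close>.\<close>
  have desc: "j < i" if "\<pi> i < \<pi> j" "\<pi> j \<le> c" "1 \<le> i" "i \<le> n" "1 \<le> j" "j \<le> n" for i j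
  proof (rule ccontr)
    assume "\<not> j < i"
    moreover have "i \<noteq> j" using that by auto
    ultimately show False
      using that A3[of 1 "Suc i" "Suc j"] by (auto simp: prepend_Suc)
  qed
  have "c \<le> 2"
  proof (rule ccontr)
    assume c2: "\<not> c \<le> 2"
    \<comment> \<open>The values \<open>3\<close>, \<open>2\<close>, \<open>1\<close>, in this order
      by \<open>desc\<close>, complete a \<open>4321\<close> with the first entry.\<close>
    obtain i1 where i1: "1 \<le> i1" "i1 \<le> n" "\<pi> i1 = 1"
      using permutes_preimage[OF p, of 1] c c2 by auto
    obtain i2 where i2: "1 \<le> i2" "i2 \<le> n" "\<pi> i2 = 2"
      using permutes_preimage[OF p, of 2] c c2 by auto
    obtain i3 where i3: "1 \<le> i3" "i3 \<le> n" "\<pi> i3 = 3"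
      using permutes_preimage[OF p, of 3] c c2 by auto
    show False
      using A4[of 1 "Suc i3" "Suc i2" "Suc i1"] desc[of i1 i2] desc[of i2 i3] c2 i1 i2 i3
      by (auto simp: prepend_Suc)
  qed
  moreover have "c \<le> \<pi> 1"
  proof (rule ccontr)
    assume "\<not> c \<le> \<pi> 1"
    moreover have "\<pi> 1 \<in> {1..n}"
      using n permutes_range[OF p] by auto
    ultimately have 1: "\<pi> 1 = 1" "c = 2" using \<open>c \<le> 2\<close> by auto
    obtain i2 where i2: "1 \<le> i2" "i2 \<le> n" "\<pi> i2 = 2"
      using permutes_preimage[OF p, of 2] c 1 by auto
    show False
      using desc[of 1 i2] 1 i2 n by auto
  qed
  ultimately show "\<pi> \<in> Av n \<and> c \<le> 2 \<and> c \<le> \<pi> 1"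
    using \<open>\<pi> \<in> Av n\<close> by blast
next
  assume R: "\<pi> \<in> Av n \<and> c \<le> 2 \<and> c \<le> \<pi> 1"
  then have A3: "\<not> (\<pi> j < \<pi> k \<and> \<pi> k < \<pi> i)" if "1 \<le> i" "i < j" "j < k" "k \<le> n" for i j k
    using that unfolding mem_Av_iff by blast
  from R have A4: "\<not> (\<pi> j < \<pi> i \<and> \<pi> k < \<pi> j \<and> \<pi> l < \<pi> k)"
    if "1 \<le> i" "i < j" "j < k" "k < l" "l \<le> n" for i j k l
    using that unfolding mem_Av_iff by blast
  have pos: "\<pi> i \<ge> 1" if "1 \<le> i" "i \<le> n" for i
    using permutes_range[OF p, of i] that by auto
  have "\<not> (prepend c \<pi> j < prepend c \<pi> k \<and> prepend c \<pi> k < prepend c \<pi> i)"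
    if le: "1 \<le> i" "i < j" "j < k" "k \<le> Suc n" for i j k
  proof
    assume v: "prepend c \<pi> j < prepend c \<pi> k \<and> prepend c \<pi> k < prepend c \<pi> i"
    obtain j' k' where jk: "j = Suc j'" "k = Suc k'" "1 \<le> j'" "j' < k'" "k' \<le> n"
      using le by (cases j; cases k) auto
    then have lt: "\<pi> j' < \<pi> k'"
      using v by (auto simp: prepend_less_iff)
    show False
    proof (cases "i = 1")
      case True
      then have "\<pi> k' \<le> c"
        using v jk by (auto simp: prepend_Suc split: if_splits)
      \<comment> \<open>The two smaller entries can only be \<open>1\<close> and \<open>2\<close>.
        Then \<pi> starts above \<open>2\<close>, and its own first entry replaces the new one in a
        \<open>312\<close>.\<close>
      then have k': "\<pi> k' = 2" and c2: "c = 2"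
        using lt pos[of j'] jk R by auto
      have "\<pi> 1 \<noteq> 2"
        using permutes_inj[OF p] k' jk by (metis inj_eq leD)
      then have "\<pi> 1 > 2"
        using R c2 by auto
      then have "j' \<noteq> 1"
        using lt k' by auto
      then show False
        using A3[of 1 j' k'] lt k' \<open>\<pi> 1 > 2\<close> jk by auto
    next
      case False
      then obtain i' where "i = Suc i'" "1 \<le> i'"
        using le by (cases i) auto
      then show False
        using A3[of i' j' k'] v jk le by (auto simp: prepend_less_iff)
    qed
  qed
  moreover have "\<not> (prepend c \<pi> j < prepend c \<pi> i \<and> prepend c \<pi> k < prepend c \<pi> j \<and> prepend c \<pi> l < prepend c \<pi> k)"
    if le: "1 \<le> i" "i < j" "j < k" "k < l" "l \<le> Suc n" for i j k l
  proof
    assume v: "prepend c \<pi> j < prepend c \<pi> i \<and> prepend c \<pi> k < prepend c \<pi> j \<and> prepend c \<pi> l < prepend c \<pi> k"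
    obtain j' k' l' where jk: "j = Suc j'" "k = Suc k'" "l = Suc l'" "1 \<le> j'" "j' < k'" "k' < l'" "l' \<le> n"
      using le by (cases j; cases k; cases l) auto
    show False
    proof (cases "i = 1")
      case True
      \<comment> \<open>Three distinct positive values would have to be at most
        \<open>2\<close>.\<close>
      then have "\<pi> j' \<le> c" "\<pi> k' < \<pi> j'" "\<pi> l' < \<pi> k'"
        using v jk by (auto simp: prepend_Suc split: if_splits)
      then show False
        using R pos[of l'] jk by auto
    next
      case False
      then obtain i' where "i = Suc i'" "1 \<le> i'"
        using le by (cases i) auto
      then show False
        using A4[of i' j' k' l'] v jk le by (auto simp: prepend_less_iff)
    qed
  qed
  ultimately show "prepend c \<pi> \<in> Av (Suc n)"
    using prepend_permutes[OF p c] unfolding mem_Av_iff by blast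
qed

section \<open>Inversions and excedances\<close>

text \<open>The set is the preimage of \<open>{1..c}\<close> under a bijection. It gives the number
  of inversions of the new first entry.\<close>

lemma card_permutes_le:
  assumes p: "\<pi> permutes {1..n}" and c: "c \<le> n"
  shows "card {j \<in> {1..n}. \<pi> j \<le> c} = c"
proof -
  have "\<pi> ` {j \<in> {1..n}. \<pi> j \<le> c} = {1..c}"
  proof (intro equalityI subsetI)
    fix v assume "v \<in> {1..c}"
    then obtain i where "1 \<le> i" "i \<le> n" "\<pi> i = v"
      using permutes_preimage[OF p, of v] c by auto
    then show "v \<in> \<pi> ` {j \<in> {1..n}. \<pi> j \<le> c}"
      using \<open>v \<in> {1..c}\<close> by auto
  qed (use permutes_range[OF p] in auto)
  then show ?thesis
    using card_image[OF permutes_inj_on[OF p], of "{j \<in> {1..n}. \<pi> j \<le> c}"] by simp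
qed

text \<open>The first entry is inverted with exactly the entries coming from values at most
  \<open>c\<close>; all other inversions are those of \<pi>, shifted.\<close>

lemma inv_count_prepend:
  assumes p: "\<pi> permutes {1..n}" and c: "c \<le> n"
  shows "inv_count (Suc n) (prepend c \<pi>) = c + inv_count n \<pi>"
proof -
  define I where "I = {(i, j). i \<in> {1..n} \<and> j \<in> {1..n} \<and> i < j \<and> \<pi> i > \<pi> j}"
  define J where "J = {j \<in> {1..n}. \<pi> j \<le> c}"
  have fin: "finite I" "finite J"
    by (rule finite_subset[of _ "{1..n} \<times> {1..n}"]) (auto simp: I_def J_def)
  have "{(i, j). i \<in> {1..Suc n} \<and> j \<in> {1..Suc n} \<and> i < j \<and> prepend c \<pi> i > prepend c \<pi> j} =
      (\<lambda>j. (1, Suc j)) ` J \<union> (\<lambda>(i, j). (Suc i, Suc j)) ` I" (is "?L = ?R")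
  proof (intro equalityI subsetI)
    fix x assume "x \<in> ?L"
    then obtain i j where x: "x = (i, j)" "1 \<le> i" "i < j" "j \<le> Suc n" "prepend c \<pi> j < prepend c \<pi> i"
      by auto
    obtain j' where j': "j = Suc j'" "1 \<le> j'" "j' \<le> n"
      using x by (cases j) auto
    show "x \<in> ?R"
    proof (cases "i = 1")
      case True
      then have "j' \<in> J"
        using x j' by (auto simp: J_def prepend_Suc split: if_splits)
      then show ?thesis using True x j' by auto
    next
      case False
      then obtain i' where i': "i = Suc i'" "1 \<le> i'"
        using x by (cases i) auto
      then have "(i', j') \<in> I"
        using x j' by (auto simp: I_def prepend_less_iff)
      then show ?thesis using x i' j' by auto
    qed
  next
    fix x assume "x \<in> ?R"
    then show "x \<in> ?L"
      by (auto simp: I_def J_def prepend_less_iff prepend_Suc)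
  qed
  also have "card \<dots> = card ((\<lambda>j. (1::nat, Suc j)) ` J) + card ((\<lambda>(i, j). (Suc i, Suc j)) ` I)"
    by (rule card_Un_disjoint) (use fin in \<open>auto simp: I_def\<close>)
  also have "card ((\<lambda>j. (1::nat, Suc j)) ` J) = c"
    using card_permutes_le[OF p c] by (subst card_image) (auto simp: inj_on_def J_def)
  also have "card ((\<lambda>(i, j). (Suc i, Suc j)) ` I) = inv_count n \<pi>"
    by (subst card_image) (auto simp: inj_on_def I_def inv_count_def)
  finally show ?thesis
    by (simp add: inv_count_def)
qed

text \<open>Positions move up by one, so an excedance survives if its value is raised too. A value
  not raised is at most \<open>2\<close> and cannot exceed its new position, which is at least
  \<open>2\<close>.\<close>

lemma exc_prepend:
  assumes c: "c \<le> 2"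
  shows "exc (Suc n) (prepend c \<pi>) = of_bool (c > 0) + card {i \<in> {1..n}. \<pi> i > i \<and> \<pi> i > c}"
proof -
  define E where "E = {i \<in> {1..n}. \<pi> i > i \<and> \<pi> i > c}"
  have "{j \<in> {1..Suc n}. prepend c \<pi> j > j} = (if c > 0 then {1} else {}) \<union> Suc ` E" (is "?L = ?R")
  proof (intro equalityI subsetI)
    fix j assume "j \<in> ?L"
    then have j: "1 \<le> j" "j \<le> Suc n" "j < prepend c \<pi> j" by auto
    show "j \<in> ?R"
    proof (cases "j = 1")
      case True
      then show ?thesis using j by auto
    next
      case False
      then obtain i where i: "j = Suc i" "1 \<le> i" "i \<le> n"
        using j by (cases j) auto
      then have "i \<in> E"
        using j c by (auto simp: E_def prepend_Suc split: if_splits)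
      then show ?thesis using i by auto
    qed
  next
    fix j assume "j \<in> ?R"
    then show "j \<in> ?L"
      by (auto simp: E_def prepend_Suc split: if_splits)
  qed
  moreover have "card \<dots> = of_bool (c > 0) + card E"
    by (subst card_Un_disjoint) (auto simp: E_def card_image)
  ultimately show ?thesis
    by (simp add: exc_def E_def)
qed

text \<open>The value at an excedance is at least \<open>2\<close>, so none is lost.\<close>

lemma exc_prepend_le_1:
  assumes c: "c \<le> 1"
  shows "exc (Suc n) (prepend c \<pi>) = c + exc n \<pi>"
proof -
  have "{i \<in> {1..n}. \<pi> i > i \<and> \<pi> i > c} = {i \<in> {1..n}. \<pi> i > i}"
    using c by auto
  then show ?thesis
    using c exc_prepend[of c n \<pi>] by (auto simp: exc_def)
qed

text \<open>The one excedance that can be lost is the value \<open>2\<close> at position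
  \<open>1\<close>. The subtraction never truncates, because \<open>1\<close> is added
  first.\<close>

lemma exc_prepend_2:
  assumes n: "n \<ge> 1"
  shows "exc (Suc n) (prepend 2 \<pi>) = 1 + exc n \<pi> - of_bool (\<pi> 1 = 2)"
proof -
  define E where "E = {i \<in> {1..n}. \<pi> i > i \<and> \<pi> i > 2}"
  have "{i \<in> {1..n}. \<pi> i > i} = (if \<pi> 1 = 2 then {1} else {}) \<union> E"
  proof (intro equalityI subsetI)
    fix i assume i: "i \<in> {i \<in> {1..n}. \<pi> i > i}"
    then have "i = 1 \<and> \<pi> 1 = 2" if "\<not> \<pi> i > 2"
      using that by (cases "i = 1") auto
    then show "i \<in> (if \<pi> 1 = 2 then {1} else {}) \<union> E"
      using i by (auto simp: E_def)
  qed (use n in \<open>auto simp: E_def split: if_splits\<close>)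
  moreover have "card \<dots> = of_bool (\<pi> 1 = 2) + card E"
    by (subst card_Un_disjoint) (auto simp: E_def)
  ultimately show ?thesis
    using exc_prepend[of 2 n \<pi>] by (simp add: exc_def E_def)
qed

section \<open>Cycles\<close>

text \<open>\<open>orbit p x\<close> collects the points reached in at least one step; that
  \<open>x\<close> is among them is where \<open>p\<close> being a permutation enters.\<close>

lemma orbit_cong_mem:
  assumes "permutation p" "y \<in> orbit p x"
  shows "orbit p y = orbit p x"
proof -
  have "x \<in> orbit p y"
    by (rule orbit_swap[OF permutation_self_in_orbit[OF assms(1)] assms(2)])
  then show ?thesis
    using orbit_trans[OF _ assms(2)] orbit_trans[OF _ \<open>x \<in> orbit p y\<close>] by blast
qed

text \<open>
  \<open>f\<close> sends orbits of \<open>q\<close> into orbits of \<open>p\<close>, and \<open>g\<close> picks for each point of \<open>A\<close> an element of \<open>B\<close>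
  lying in its orbit. With the roles of \<open>p\<close> and \<open>q\<close> exchanged this shows that inserting a point into
  an edge of a cycle does not change the number of cycles.
\<close>

lemma card_orbits_le:
  assumes p: "permutation p" and B: "finite B"
    and g: "\<And>a. a \<in> A \<Longrightarrow> g a \<in> B" "\<And>a. a \<in> A \<Longrightarrow> f (g a) \<in> orbit p a"
    and f: "\<And>b. b \<in> B \<Longrightarrow> q b \<in> B" "\<And>b. b \<in> B \<Longrightarrow> f (q b) \<in> orbit p (f b)"
  shows "card (orbit p ` A) \<le> card (orbit q ` B)"
proof -
  have step: "b' \<in> B \<and> f b' \<in> orbit p (f b)" if "b' \<in> orbit q b" "b \<in> B" for b b'
    using that by induction (auto intro: f orbit_trans)
  \<comment> \<open>All points of the \<open>q\<close>-orbit of \<open>g a\<close> are sent into the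
    one \<open>p\<close>-orbit of \<open>a\<close>, which is thus a function of that
    \<open>q\<close>-orbit.\<close>
  have "orbit p a = (\<Union>b \<in> orbit q (g a). orbit p (f b))" if "a \<in> A" for a
  proof -
    have "orbit p (f b) = orbit p a" if "b \<in> orbit q (g a)" for b
      using orbit_cong_mem[OF p] step[OF that] g \<open>a \<in> A\<close> by metis
    then show ?thesis
      using orbit_nonempty[of q "g a"] by auto
  qed
  then have "orbit p ` A \<subseteq> (\<lambda>Q. \<Union>b \<in> Q. orbit p (f b)) ` orbit q ` B"
    using g(1) by blast
  then show ?thesis
    using B by (intro surj_card_le) auto
qed

lemma permutes_imp_permutation: "\<pi> permutes {1..n::nat} \<Longrightarrow> permutation \<pi>"
  unfolding permutation_permutes by (intro exI[of _ "{1..n}"]) simp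

text \<open>The point \<open>1\<close> is fixed, and \<open>Suc\<close> conjugates \<pi> to the
  action on the other points; comparing orbits both ways gives equal counts there.\<close>

lemma cyc_prepend_0:
  assumes p: "\<pi> permutes {1..n}"
  shows "cyc (Suc n) (prepend 0 \<pi>) = Suc (cyc n \<pi>)"
proof -
  let ?p = "prepend 0 \<pi>"
  have pp: "permutation ?p" "permutation \<pi>"
    using prepend_permutes[OF p, of 0] p by (auto intro: permutes_imp_permutation simp del: One_nat_def)
  note self = permutation_self_in_orbit[OF pp(1)] permutation_self_in_orbit[OF pp(2)]
  have s: "?p (Suc i) = Suc (\<pi> i)" if "i \<in> {1..n}" for i
    using that permutes_range[OF p that] by (auto simp: prepend_Suc)
  have eq: "orbit ?p ` {1..Suc n} = insert {1} (orbit ?p ` Suc ` {1..n})"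
  proof -
    have "x = 1" if "x \<in> orbit ?p 1" for x
      using that by induction auto
    then have "orbit ?p 1 = {1}"
      using self(1)[of 1] by auto
    moreover have "{1..Suc n} = insert 1 (Suc ` {1..n})"
      by (simp add: atLeastAtMost_insertL)
    ultimately show ?thesis by (simp only: image_insert)
  qed
  have ne: "{1} \<noteq> orbit ?p i" if "i \<in> Suc ` {1..n}" for i
  proof
    assume "{1} = orbit ?p i"
    then have "i = 1"
      using self(1)[of i] by blast
    then show False
      using that by auto
  qed
  have "card (orbit ?p ` Suc ` {1..n}) \<le> cyc n \<pi>"
    unfolding cyc_def
  proof (rule card_orbits_le[OF pp(1), of _ _ "\<lambda>i. i - 1" Suc])
    fix b assume "b \<in> {1..n}"
    then show "\<pi> b \<in> {1..n}" "Suc (\<pi> b) \<in> orbit ?p (Suc b)"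
      using permutes_range[OF p] s[of b] orbit.base[of ?p "Suc b"] by auto
  qed (auto simp: self)
  moreover have "cyc n \<pi> \<le> card (orbit ?p ` Suc ` {1..n})"
    unfolding cyc_def
  proof (rule card_orbits_le[OF pp(2), of _ _ Suc "\<lambda>i. i - 1"])
    fix b assume "b \<in> Suc ` {1..n}"
    then obtain i where i: "b = Suc i" "i \<in> {1..n}" by blast
    then show "?p b \<in> Suc ` {1..n}" "?p b - 1 \<in> orbit \<pi> (b - 1)"
      using permutes_range[OF p i(2)] s[OF i(2)] orbit.base[of \<pi> i] by (auto simp del: One_nat_def)
  qed (auto simp: self)
  moreover have "{1} \<notin> orbit ?p ` Suc ` {1..n}"
    using ne by blast
  ultimately show ?thesis
    unfolding cyc_def eq by simp
qed

text \<open>With each old point \<open>i\<close> renamed \<open>Suc i\<close>, the edge into old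
  \<open>1\<close> becomes a path through the new \<open>1\<close> to \<open>2\<close>. The map
  \<open>?g\<close> merges the inserted point with the one behind it.\<close>

lemma cyc_prepend_1:
  assumes p: "\<pi> permutes {1..n}" and n: "n \<ge> 1"
  shows "cyc (Suc n) (prepend 1 \<pi>) = cyc n \<pi>"
proof -
  let ?p = "prepend 1 \<pi>" and ?g = "\<lambda>i. if i = 1 then 1 else i - 1"
  have pp: "permutation ?p" "permutation \<pi>"
    using prepend_permutes[OF p n] p by (auto intro: permutes_imp_permutation simp del: One_nat_def)
  note self = permutation_self_in_orbit[OF pp(1)] permutation_self_in_orbit[OF pp(2)]
  have s: "\<pi> i \<in> {1..n} \<and> ?p (Suc i) = (if \<pi> i = 1 then 1 else Suc (\<pi> i))" if "i \<in> {1..n}" for i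
    using that permutes_range[OF p that] by (auto simp: prepend_Suc)
  have s1: "?p 1 = 2" by simp
  have s2: "2 \<in> orbit ?p 1"
    using orbit.base[of ?p 1] s1 by (simp only:)
  show ?thesis
    unfolding cyc_def
  proof (rule antisym)
    show "card (orbit ?p ` {1..Suc n}) \<le> card (orbit \<pi> ` {1..n})"
    proof (rule card_orbits_le[OF pp(1), of _ _ ?g Suc])
      fix b assume b: "b \<in> {1..n}"
      show "\<pi> b \<in> {1..n}" using s b by blast
      \<comment> \<open>If \<open>\<pi> b = 1\<close>, two steps are needed, by way of the inserted
        point.\<close>
      show "Suc (\<pi> b) \<in> orbit ?p (Suc b)"
        using s[OF b] orbit.base[of ?p "Suc b"] s2 orbit_trans[of 2 ?p 1 "Suc b"]
        by (auto simp: numeral_2_eq_2 split: if_splits)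
    qed (use n s2 self in \<open>auto simp: numeral_2_eq_2\<close>)
    show "card (orbit \<pi> ` {1..n}) \<le> card (orbit ?p ` {1..Suc n})"
    proof (rule card_orbits_le[OF pp(2), of _ _ Suc ?g])
      fix a assume a: "a \<in> {1..Suc n}"
      show "?p a \<in> {1..Suc n}"
        using a permutes_range[OF prepend_permutes[OF p n]] by blast
      show "?g (?p a) \<in> orbit \<pi> (?g a)"
      proof (cases "a = 1")
        case True
        then show ?thesis using self(2) by simp
      next
        case False
        then obtain i where i: "a = Suc i" "i \<in> {1..n}"
          using a by (cases a) auto
        then show ?thesis
          using s[OF i(2)] orbit.base[of \<pi> i] by auto
      qed
    qed (use self in auto)
  qed
qed

text \<open>Old points are renamed \<open>i + 2\<close>. The point \<open>2\<close> is fixed, and on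
  the remaining set \<open>?A\<close> the edge into old \<open>1\<close>, now \<open>3\<close>,
  passes through the new \<open>1\<close>.\<close>

lemma cyc_prepend_2_prepend_1:
  assumes p: "\<pi> permutes {1..n}" and n: "n \<ge> 1"
  shows "cyc (Suc (Suc n)) (prepend 2 (prepend 1 \<pi>)) = Suc (cyc n \<pi>)"
proof -
  let ?p = "prepend 2 (prepend 1 \<pi>)" and ?g = "\<lambda>i::nat. if i = 1 then 1 else i - 2" and ?f = "\<lambda>i. i + 2"
    and ?A = "{1..Suc (Suc n)} - {2}"
  have P: "?p permutes {1..Suc (Suc n)}"
    using n by (intro prepend_permutes p) auto
  have pp: "permutation ?p" "permutation \<pi>"
    using P p by (auto intro: permutes_imp_permutation simp del: One_nat_def)
  note self = permutation_self_in_orbit[OF pp(1)] permutation_self_in_orbit[OF pp(2)]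
  have s: "\<pi> i \<in> {1..n} \<and> ?p (i + 2) = (if \<pi> i = 1 then 1 else \<pi> i + 2)" if "i \<in> {1..n}" for i
    using that permutes_range[OF p that] by (auto simp: prepend_Suc)
  have s1: "?p 1 = 3" and s2: "?p 2 = 2" by (auto simp: prepend_def)
  have s3: "3 \<in> orbit ?p 1"
    using orbit.base[of ?p 1] s1 by simp
  have eq: "orbit ?p ` {1..Suc (Suc n)} = insert {2} (orbit ?p ` ?A)"
  proof -
    have "x = 2" if "x \<in> orbit ?p 2" for x
      using that by induction (simp_all only: s2)
    then have "orbit ?p 2 = {2}"
      using self(1)[of 2] by auto
    moreover have "{1..Suc (Suc n)} = insert 2 ?A"
      by auto
    ultimately show ?thesis by (metis image_insert)
  qed
  have ne: "{2} \<noteq> orbit ?p i" if "i \<in> ?A" for i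
  proof
    assume "{2} = orbit ?p i"
    then have "i = 2"
      using self(1)[of i] by blast
    then show False
      using that by auto
  qed
  have "card (orbit ?p ` ?A) \<le> card (orbit \<pi> ` {1..n})"
  proof (rule card_orbits_le[OF pp(1), of _ _ ?g ?f])
    fix b assume b: "b \<in> {1..n}"
    show "\<pi> b \<in> {1..n}" using s b by blast
    show "\<pi> b + 2 \<in> orbit ?p (b + 2)"
      using s[OF b] orbit.base[of ?p "b + 2"] s3 orbit_trans[of 3 ?p 1 "b + 2"]
      by (auto simp: numeral_3_eq_3 split: if_splits)
  next
    fix a assume a: "a \<in> ?A"
    then show "?g a \<in> {1..n}"
      using n by auto
    show "?g a + 2 \<in> orbit ?p a"
    proof (cases "a = 1")
      case True
      then show ?thesis using s3 by (simp add: numeral_3_eq_3)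
    next
      case False
      then have "a \<ge> 3" using a by auto
      then have "?g a + 2 = a" by simp
      then show ?thesis using self(1)[of a] by (simp only:)
    qed
  qed auto
  moreover have "card (orbit \<pi> ` {1..n}) \<le> card (orbit ?p ` ?A)"
  proof (rule card_orbits_le[OF pp(2), of _ _ ?f ?g])
    fix a assume a: "a \<in> ?A"
    \<comment> \<open>Injectivity keeps other points from reaching the fixed point, so
      \<open>?A\<close> is invariant.\<close>
    have "?p a \<noteq> 2"
      using permutes_inj[OF P] s2 a by (metis DiffD2 injD singletonI)
    then show "?p a \<in> ?A"
      using a permutes_range[OF P] by blast
    show "?g (?p a) \<in> orbit \<pi> (?g a)"
    proof (cases "a = 1")
      case True
      then show ?thesis using self(2) s1 by simp
    next
      case False
      then obtain i where i: "a = i + 2" "i \<in> {1..n}"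
        using a by (intro that[of "a - 2"]) auto
      then show ?thesis
        using s[OF i(2)] orbit.base[of \<pi> i] by auto
    qed
  qed (use self in auto)
  moreover have "{2} \<notin> orbit ?p ` ?A"
    using ne by blast
  ultimately show ?thesis
    unfolding cyc_def eq by simp
qed

text \<open>Old points are renamed \<open>i + 2\<close>, and the new points \<open>1\<close>,
  \<open>2\<close> are inserted just before old \<open>1\<close>, \<open>2\<close>, now
  \<open>3\<close>, \<open>4\<close>. Again \<open>?g\<close> merges each inserted point with its
  successor.\<close>

lemma cyc_prepend_2_prepend_2:
  assumes p: "\<pi> permutes {1..n}" and n: "n \<ge> 2"
  shows "cyc (Suc (Suc n)) (prepend 2 (prepend 2 \<pi>)) = cyc n \<pi>"
proof -
  let ?p = "prepend 2 (prepend 2 \<pi>)" and ?g = "\<lambda>i::nat. if i \<le> 2 then i else i - 2" and ?f = "\<lambda>i. i + 2"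
  have P: "?p permutes {1..Suc (Suc n)}"
    using n by (intro prepend_permutes p) auto
  have pp: "permutation ?p" "permutation \<pi>"
    using P p by (auto intro: permutes_imp_permutation simp del: One_nat_def)
  note self = permutation_self_in_orbit[OF pp(1)] permutation_self_in_orbit[OF pp(2)]
  have s: "\<pi> i \<in> {1..n} \<and> ?p (i + 2) = (if \<pi> i \<le> 2 then \<pi> i else \<pi> i + 2)" if "i \<in> {1..n}" for i
    using that permutes_range[OF p that] by (auto simp: prepend_Suc)
  have s1: "?p i = i + 2" if "i = 1 \<or> i = 2" for i
    using that by (auto simp: prepend_def)
  have s2: "i + 2 \<in> orbit ?p i" if "i = 1 \<or> i = 2" for i
    using orbit.base[of ?p i] s1[OF that] by simp
  show ?thesis
    unfolding cyc_def
  proof (rule antisym)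
    show "card (orbit ?p ` {1..Suc (Suc n)}) \<le> card (orbit \<pi> ` {1..n})"
    proof (rule card_orbits_le[OF pp(1), of _ _ ?g ?f])
      fix b assume b: "b \<in> {1..n}"
      show "\<pi> b \<in> {1..n}" using s b by blast
      show "\<pi> b + 2 \<in> orbit ?p (b + 2)"
      proof (cases "\<pi> b \<le> 2")
        case True
        \<comment> \<open>This edge is one of the two subdivided ones, so the path has two
          steps.\<close>
        then have "\<pi> b = 1 \<or> \<pi> b = 2" using s[OF b] by auto
        then have "\<pi> b + 2 \<in> orbit ?p (\<pi> b)" by (rule s2)
        moreover have "\<pi> b \<in> orbit ?p (b + 2)"
          using s[OF b] orbit.base[of ?p "b + 2"] True by simp
        ultimately show ?thesis by (rule orbit_trans)
      next
        case False
        then show ?thesis using s[OF b] orbit.base[of ?p "b + 2"] by simp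
      qed
    next
      fix a assume a: "a \<in> {1..Suc (Suc n)}"
      then show "?g a \<in> {1..n}" using n by auto
      show "?g a + 2 \<in> orbit ?p a"
      proof (cases "a \<le> 2")
        case True
        then have "a = 1 \<or> a = 2" using a by auto
        then show ?thesis using s2[of a] True by simp
      next
        case False
        then have "?g a + 2 = a" by simp
        then show ?thesis using self(1)[of a] by (simp only:)
      qed
    qed auto
    show "card (orbit \<pi> ` {1..n}) \<le> card (orbit ?p ` {1..Suc (Suc n)})"
    proof (rule card_orbits_le[OF pp(2), of _ _ ?f ?g])
      fix a assume a: "a \<in> {1..Suc (Suc n)}"
      show "?p a \<in> {1..Suc (Suc n)}"
        using a permutes_range[OF P] by blast
      show "?g (?p a) \<in> orbit \<pi> (?g a)"
      proof (cases "a \<le> 2")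
        case True
        then have "a = 1 \<or> a = 2" using a by auto
        then show ?thesis using self(2)[of a] s1[of a] by auto
      next
        case False
        then obtain i where i: "a = i + 2" "i \<in> {1..n}"
          using a by (intro that[of "a - 2"]) auto
        then show ?thesis
          using s[OF i(2)] orbit.base[of \<pi> i] by auto
      qed
    qed (use self in auto)
  qed
qed

section \<open>Recurrences\<close>

declare One_nat_def [simp del]

text \<open>With \<open>One_nat_def\<close> removed from the simpset, \<open>prepend_1\<close> is
  needed in this form as well.\<close>

lemma prepend_one [simp]: "prepend c \<pi> 1 = Suc c"
  using prepend_1 by (simp add: One_nat_def)

section \<open>Avoiders sorted by first entry\<close>

definition Av_first :: "nat \<Rightarrow> nat \<Rightarrow> (nat \<Rightarrow> nat) set" where
  "Av_first c n = {\<pi> \<in> Av n. \<pi> 1 = c}"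

lemma finite_Av_first [simp]: "finite (Av_first c n)"
  by (simp add: Av_first_def finite_avoiders)

lemma Av_permutes: "\<pi> \<in> Av n \<Longrightarrow> \<pi> permutes {1..n}"
  by (simp add: mem_Av_iff)

lemma Av_first_permutes: "\<pi> \<in> Av_first c n \<Longrightarrow> \<pi> permutes {1..n}"
  by (simp add: Av_first_def mem_Av_iff)

lemma Av_first_Suc:
  assumes n: "n \<ge> 1" and c: "c \<le> 2"
  shows "Av_first (Suc c) (Suc n) = prepend c ` {\<pi> \<in> Av n. c \<le> \<pi> 1}"
proof (intro equalityI subsetI)
  fix \<pi> assume \<pi>: "\<pi> \<in> Av_first (Suc c) (Suc n)"
  obtain d \<sigma> where \<sigma>: "d \<le> n" "\<sigma> permutes {1..n}" "\<pi> = prepend d \<sigma>"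
    using permutes_Suc_obtains_prepend[OF Av_first_permutes[OF \<pi>]] .
  then have "d = c" "prepend d \<sigma> \<in> Av (Suc n)"
    using \<pi> by (auto simp: Av_first_def)
  then show "\<pi> \<in> prepend c ` {\<pi> \<in> Av n. c \<le> \<pi> 1}"
    using prepend_mem_Av_iff[OF n \<sigma>(2,1)] \<sigma>(3) by blast
next
  fix \<pi> assume "\<pi> \<in> prepend c ` {\<pi> \<in> Av n. c \<le> \<pi> 1}"
  then obtain \<sigma> where \<sigma>: "\<pi> = prepend c \<sigma>" "\<sigma> \<in> Av n" "c \<le> \<sigma> 1" by blast
  \<comment> \<open>With \<open>c \<le> \<sigma> 1\<close> this yields \<open>c \<le> n\<close>, a
    hypothesis of \<open>prepend_mem_Av_iff\<close>.\<close>
  have "\<sigma> 1 \<le> n"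
    using permutes_range[OF Av_permutes[OF \<sigma>(2)], of 1] n by simp
  then show "\<pi> \<in> Av_first (Suc c) (Suc n)"
    using prepend_mem_Av_iff[OF n Av_permutes[OF \<sigma>(2)], of c] \<sigma> c by (simp add: Av_first_def)
qed

lemma Av_1: "Av 1 = {id}"
proof -
  have "id \<in> Av 1"
    unfolding mem_Av_iff by (auto simp: permutes_id)
  then show ?thesis
    using Av_permutes[of _ 1] by auto
qed

text \<open>The empty permutation is \<open>id\<close>, whose value at \<open>1\<close> is
  \<open>1\<close> although \<open>1\<close> lies outside the range; hence
  \<open>c \<noteq> 1\<close>.\<close>

lemma Av_first_0: "c \<noteq> 1 \<Longrightarrow> Av_first c 0 = {}"
  by (auto simp: Av_first_def mem_Av_iff)

lemma Av_first_1: "c \<noteq> 1 \<Longrightarrow> Av_first c 1 = {}"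
  unfolding Av_first_def Av_1 by auto

text \<open>For \<open>n > 1\<close> the word is some \<open>prepend d \<sigma>\<close>, and
  avoidance forces \<open>d \<le> 2\<close>. So three classes cover all avoiders.\<close>

lemma Av_apply_1:
  assumes n: "n \<ge> 1" and \<pi>: "\<pi> \<in> Av n"
  shows "\<pi> 1 \<in> {1, 2, 3}"
proof (cases "n = 1")
  case True
  then show ?thesis using \<pi> by (simp add: Av_1)
next
  case False
  then obtain m where m: "n = Suc m" "m \<ge> 1"
    using n by (cases n) (auto simp: One_nat_def)
  obtain d \<sigma> where \<sigma>: "d \<le> m" "\<sigma> permutes {1..m}" "\<pi> = prepend d \<sigma>"
    using permutes_Suc_obtains_prepend[OF Av_permutes[OF \<pi>[unfolded m(1)]]] .
  then have "d \<le> 2"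
    using prepend_mem_Av_iff[OF m(2) \<sigma>(2,1)] \<pi> m by blast
  then show ?thesis
    using \<sigma>(3) by auto
qed

lemma Av_eq:
  assumes "n \<ge> 1"
  shows "Av n = Av_first 1 n \<union> (Av_first 2 n \<union> Av_first 3 n)"
  unfolding Av_first_def by (auto dest: Av_apply_1[OF assms])

lemma Av_ge_2_eq:
  assumes "n \<ge> 1"
  shows "{\<pi> \<in> Av n. 2 \<le> \<pi> 1} = Av_first 2 n \<union> Av_first 3 n"
proof (intro equalityI subsetI)
  fix \<pi> assume "\<pi> \<in> {\<pi> \<in> Av n. 2 \<le> \<pi> 1}"
  then show "\<pi> \<in> Av_first 2 n \<union> Av_first 3 n"
    using Av_apply_1[OF assms, of \<pi>] by (auto simp: Av_first_def)
qed (auto simp: Av_first_def)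

lemma Av_first_disjoint: "c \<noteq> d \<Longrightarrow> Av_first c n \<inter> Av_first d n = {}"
  by (auto simp: Av_first_def)

section \<open>Weights and their recurrences\<close>

definition weight :: "nat \<Rightarrow> (nat \<Rightarrow> nat) \<Rightarrow> poly_txy" where
  "weight n \<pi> = var_t ^ cyc n \<pi> * var_x ^ exc n \<pi> * var_y ^ inv_count n \<pi>"

definition total_weight :: "nat \<Rightarrow> (nat \<Rightarrow> nat) set \<Rightarrow> poly_txy" where
  "total_weight n S = (\<Sum>\<pi>\<in>S. weight n \<pi>)"

lemma total_weight_Av:
  assumes "n \<ge> 1"
  shows "total_weight n (Av n) =
    total_weight n (Av_first 1 n) + total_weight n (Av_first 2 n) + total_weight n (Av_first 3 n)"
  unfolding Av_eq[OF assms] total_weight_def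
  by (simp add: sum.union_disjoint Av_first_disjoint Int_Un_distrib add.assoc)

lemma sum_prepend_image:
  assumes "\<And>\<pi>. \<pi> \<in> S \<Longrightarrow> \<pi> permutes {1..n}"
  shows "(\<Sum>\<pi>\<in>prepend c ` S. h \<pi>) = (\<Sum>\<pi>\<in>S. h (prepend c \<pi>))"
proof -
  have "inj_on (prepend c) S"
  proof (rule inj_onI)
    fix \<pi> \<sigma> assume "\<pi> \<in> S" "\<sigma> \<in> S" "prepend c \<pi> = prepend c \<sigma>"
    then show "\<pi> = \<sigma>"
      using prepend_inject[of \<pi> n \<sigma> c c] assms by blast
  qed
  then show ?thesis
    by (simp add: sum.reindex)
qed

lemma Av_first_2_Suc:
  assumes "n \<ge> 1"
  shows "Av_first 2 (Suc n) = prepend 1 ` Av n"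
proof -
  have "1 \<le> \<pi> 1" if "\<pi> \<in> Av n" for \<pi>
    using permutes_range[OF Av_permutes[OF that], of 1] assms by simp
  then have "{\<pi> \<in> Av n. 1 \<le> \<pi> 1} = Av n"
    by blast
  then show ?thesis
    using Av_first_Suc[OF assms, of 1] by simp
qed

text \<open>Here the condition \<open>c \<le> \<pi> 1\<close> excludes words starting with
  \<open>1\<close>, so the recursion has to distinguish first entries.\<close>

lemma Av_first_3_Suc:
  assumes "n \<ge> 1"
  shows "Av_first 3 (Suc n) = prepend 2 ` (Av_first 2 n \<union> Av_first 3 n)"
  using Av_first_Suc[OF assms, of 2] unfolding Av_ge_2_eq[OF assms] by simp

lemma total_weight_first_1:
  assumes "n \<ge> 1"
  shows "total_weight (Suc n) (Av_first 1 (Suc n)) = var_t * total_weight n (Av n)"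
proof -
  have "Av_first 1 (Suc n) = prepend 0 ` Av n"
    using Av_first_Suc[OF assms, of 0] by (simp add: One_nat_def)
  moreover have "weight (Suc n) (prepend 0 \<pi>) = var_t * weight n \<pi>" if "\<pi> \<in> Av n" for \<pi>
    using cyc_prepend_0[OF Av_permutes[OF that]] exc_prepend_le_1[of 0 n \<pi>]
      inv_count_prepend[OF Av_permutes[OF that], of 0]
    by (simp add: weight_def algebra_simps)
  ultimately show ?thesis
    by (simp add: total_weight_def sum_prepend_image[OF Av_permutes] sum_distrib_left)
qed

lemma total_weight_first_2:
  assumes "n \<ge> 1"
  shows "total_weight (Suc n) (Av_first 2 (Suc n)) = var_x * var_y * total_weight n (Av n)"
proof -
  have "weight (Suc n) (prepend 1 \<pi>) = var_x * var_y * weight n \<pi>" if "\<pi> \<in> Av n" for \<pi>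
    using cyc_prepend_1[OF Av_permutes[OF that] assms] exc_prepend_le_1[of 1 n \<pi>]
      inv_count_prepend[OF Av_permutes[OF that] assms]
    by (simp add: weight_def power_add algebra_simps)
  then show ?thesis
    by (simp add: Av_first_2_Suc[OF assms] total_weight_def sum_prepend_image[OF Av_permutes] sum_distrib_left)
qed

text \<open>The inner step creates the excedance \<open>2\<close> at position \<open>1\<close> and
  the outer one trades it for its own, a net gain of one; the inversions grow by
  \<open>1 + 2\<close>.\<close>

lemma weight_prepend_2_prepend_1:
  assumes p: "\<pi> permutes {1..n}" and n: "n \<ge> 1"
  shows "weight (Suc (Suc n)) (prepend 2 (prepend 1 \<pi>)) = var_t * var_x * var_y ^ 3 * weight n \<pi>"
proof -
  have p1: "prepend 1 \<pi> permutes {1..Suc n}"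
    by (rule prepend_permutes[OF p n])
  have "exc (Suc (Suc n)) (prepend 2 (prepend 1 \<pi>)) = 1 + exc n \<pi>"
    using exc_prepend_2[of "Suc n"] exc_prepend_le_1[of 1 n \<pi>] by simp
  moreover have "inv_count (Suc (Suc n)) (prepend 2 (prepend 1 \<pi>)) = 3 + inv_count n \<pi>"
    using inv_count_prepend[OF p1, of 2] inv_count_prepend[OF p n] n by simp
  ultimately show ?thesis
    using cyc_prepend_2_prepend_1[OF p n] by (simp add: weight_def power_add algebra_simps)
qed

text \<open>The outer step acts on a word starting with \<open>3\<close> and gains an excedance; the
  inner one gains one unless \<open>\<pi> 1 = 2\<close>. The inversions grow by
  \<open>2 + 2\<close>.\<close>

lemma weight_prepend_2_prepend_2:
  assumes p: "\<pi> permutes {1..n}" and n: "n \<ge> 2"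
  shows "weight (Suc (Suc n)) (prepend 2 (prepend 2 \<pi>)) =
    (if \<pi> 1 = 2 then var_x * var_y ^ 4 else var_x ^ 2 * var_y ^ 4) * weight n \<pi>"
proof -
  have p1: "prepend 2 \<pi> permutes {1..Suc n}"
    by (rule prepend_permutes[OF p n])
  have "exc (Suc (Suc n)) (prepend 2 (prepend 2 \<pi>)) = 2 + exc n \<pi> - of_bool (\<pi> 1 = 2)"
    using exc_prepend_2[of "Suc n"] exc_prepend_2[of n] n by simp
  then have "exc (Suc (Suc n)) (prepend 2 (prepend 2 \<pi>)) = (if \<pi> 1 = 2 then 1 else 2) + exc n \<pi>"
    by simp
  moreover have "inv_count (Suc (Suc n)) (prepend 2 (prepend 2 \<pi>)) = 4 + inv_count n \<pi>"
    using inv_count_prepend[OF p1, of 2] inv_count_prepend[OF p n] n by simp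
  ultimately show ?thesis
    using cyc_prepend_2_prepend_2[OF p n] by (simp add: weight_def power_add algebra_simps)
qed

text \<open>Two letters are removed at once: a word starting with \<open>3\<close> leaves one
  starting with \<open>2\<close> or \<open>3\<close>, and each of these is split again, since cycles
  are controlled only for the pair of steps.\<close>

lemma total_weight_first_3:
  assumes n: "n \<ge> 1"
  shows "total_weight (Suc (Suc n)) (Av_first 3 (Suc (Suc n))) =
    var_t * var_x * var_y ^ 3 * total_weight n (Av n)
    + var_x * var_y ^ 4 * total_weight n (Av_first 2 n)
    + var_x ^ 2 * var_y ^ 4 * total_weight n (Av_first 3 n)"
proof -
  let ?w = "weight (Suc (Suc n))"
  \<comment> \<open>A first entry of at least \<open>2\<close> forces length at least
    \<open>2\<close>, as \<open>weight_prepend_2_prepend_2\<close> requires.\<close>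
  have n2: "n \<ge> 2" if "\<pi> \<in> Av_first c n" "c \<ge> 2" for \<pi> c
    using permutes_range[of \<pi> n 1] that n by (auto simp: Av_first_def dest: Av_permutes)
  have p: "\<pi> permutes {1..m}" if "\<pi> \<in> Av_first 2 m \<union> Av_first 3 m" for \<pi> m
    using that Av_first_permutes by blast
  have "total_weight (Suc (Suc n)) (Av_first 3 (Suc (Suc n))) =
      (\<Sum>\<sigma>\<in>Av_first 2 (Suc n) \<union> Av_first 3 (Suc n). ?w (prepend 2 \<sigma>))"
    unfolding Av_first_3_Suc[of "Suc n", simplified] total_weight_def by (rule sum_prepend_image[OF p])
  also have "\<dots> = (\<Sum>\<sigma>\<in>Av_first 2 (Suc n). ?w (prepend 2 \<sigma>)) + (\<Sum>\<sigma>\<in>Av_first 3 (Suc n). ?w (prepend 2 \<sigma>))"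
    by (simp add: sum.union_disjoint Av_first_disjoint)
  also have "(\<Sum>\<sigma>\<in>Av_first 2 (Suc n). ?w (prepend 2 \<sigma>)) = (\<Sum>\<pi>\<in>Av n. ?w (prepend 2 (prepend 1 \<pi>)))"
    by (simp add: Av_first_2_Suc[OF n] sum_prepend_image[OF Av_permutes])
  also have "\<dots> = var_t * var_x * var_y ^ 3 * total_weight n (Av n)"
    using n by (simp add: weight_prepend_2_prepend_1[OF Av_permutes] total_weight_def sum_distrib_left)
  also have "(\<Sum>\<sigma>\<in>Av_first 3 (Suc n). ?w (prepend 2 \<sigma>)) =
      (\<Sum>\<pi>\<in>Av_first 2 n. ?w (prepend 2 (prepend 2 \<pi>))) + (\<Sum>\<pi>\<in>Av_first 3 n. ?w (prepend 2 (prepend 2 \<pi>)))"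
    unfolding Av_first_3_Suc[OF n] by (subst sum_prepend_image[OF p]) (simp_all add: sum.union_disjoint Av_first_disjoint)
  also have "(\<Sum>\<pi>\<in>Av_first 2 n. ?w (prepend 2 (prepend 2 \<pi>))) = var_x * var_y ^ 4 * total_weight n (Av_first 2 n)"
    unfolding total_weight_def sum_distrib_left
  proof (rule sum.cong[OF refl])
    fix \<pi> assume \<pi>: "\<pi> \<in> Av_first 2 n"
    then show "?w (prepend 2 (prepend 2 \<pi>)) = var_x * var_y ^ 4 * weight n \<pi>"
      using weight_prepend_2_prepend_2[OF Av_first_permutes[OF \<pi>] n2[OF \<pi>]] by (simp add: Av_first_def)
  qed
  also have "(\<Sum>\<pi>\<in>Av_first 3 n. ?w (prepend 2 (prepend 2 \<pi>))) = var_x ^ 2 * var_y ^ 4 * total_weight n (Av_first 3 n)"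
    unfolding total_weight_def sum_distrib_left
  proof (rule sum.cong[OF refl])
    fix \<pi> assume \<pi>: "\<pi> \<in> Av_first 3 n"
    then show "?w (prepend 2 (prepend 2 \<pi>)) = var_x ^ 2 * var_y ^ 4 * weight n \<pi>"
      using weight_prepend_2_prepend_2[OF Av_first_permutes[OF \<pi>] n2[OF \<pi>]] by (simp add: Av_first_def)
  qed
  finally show ?thesis
    by (simp add: add.assoc)
qed

section \<open>The generating function\<close>

text \<open>Grouping the avoiders by their triple of statistics turns counts times monomials into a
  sum of weights.\<close>

lemma B_gf_nth: "B_gf $ n = (if n \<ge> 1 then total_weight n (Av n) else 0)"
proof -
  define g where "g \<pi> = (cyc n \<pi>, exc n \<pi>, inv_count n \<pi>)" for \<pi>
  define T where "T = g ` Av n"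
  define h where "h = (\<lambda>(k, l, j). of_nat (num_avoiders n k l j) * var_t ^ k * var_x ^ l * var_y ^ j)"
  have num: "num_avoiders n k l j = card {\<pi> \<in> Av n. g \<pi> = (k, l, j)}" for k l j
    by (simp add: num_avoiders_def g_def)
  have fin: "finite T"
    by (simp add: T_def finite_avoiders)
  \<comment> \<open>Triples that no avoider realises contribute zero.\<close>
  have "Sum_any h = sum h T"
  proof (rule Sum_any.expand_superset[OF fin], rule subsetI)
    fix a assume "a \<in> {a. h a \<noteq> 0}"
    then obtain k l j where a: "a = (k, l, j)" "num_avoiders n k l j \<noteq> 0"
      by (cases a) (auto simp: h_def)
    then have "{\<pi> \<in> Av n. g \<pi> = a} \<noteq> {}"
      unfolding num by (auto simp: card_gt_0_iff)
    then show "a \<in> T"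
      by (auto simp: T_def)
  qed
  also have "\<dots> = (\<Sum>a\<in>T. \<Sum>\<pi> | \<pi> \<in> Av n \<and> g \<pi> = a. weight n \<pi>)"
  proof (rule sum.cong[OF refl])
    fix a :: "nat \<times> nat \<times> nat"
    obtain k l j where a: "a = (k, l, j)" by (cases a)
    have "(\<Sum>\<pi> | \<pi> \<in> Av n \<and> g \<pi> = a. weight n \<pi>) =
        (\<Sum>\<pi> | \<pi> \<in> Av n \<and> g \<pi> = a. var_t ^ k * var_x ^ l * var_y ^ j)"
      by (rule sum.cong) (auto simp: a g_def weight_def)
    then show "h a = (\<Sum>\<pi> | \<pi> \<in> Av n \<and> g \<pi> = a. weight n \<pi>)"
      by (simp add: h_def a num mult.assoc)
  qed
  also have "\<dots> = total_weight n (Av n)"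
    unfolding total_weight_def by (rule sum.group) (simp_all add: fin finite_avoiders T_def)
  finally show ?thesis
    by (simp add: B_gf_def h_def)
qed

lemma total_weight_empty [simp]: "total_weight n {} = 0"
  by (simp add: total_weight_def)

lemma total_weight_Av_1: "total_weight 1 (Av 1) = var_t"
proof -
  have "cyc 1 id = 1" "exc 1 id = 0"
    by (auto simp: cyc_def exc_def)
  moreover have "inv_count 1 id = 0"
    unfolding inv_count_def by (rule card_eq_0_iff[THEN iffD2]) auto
  ultimately show ?thesis
    by (simp add: total_weight_def Av_1 weight_def)
qed

section \<open>Equations for the generating functions and their elimination\<close>

definition first_gf :: "nat \<Rightarrow> poly_txy fps" where
  "first_gf c = Abs_fps (\<lambda>n. total_weight n (Av_first c n))"

text \<open>The first summand is the word of length \<open>1\<close>; for longer words the classes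
  with first entry \<open>1\<close> and \<open>2\<close> contribute the factors \<open>var_t\<close>
  and \<open>var_x * var_y\<close>.\<close>

lemma B_gf_eq:
  "B_gf = fps_const var_t * fps_X + fps_const (var_t + var_x * var_y) * (fps_X * B_gf) + first_gf 3"
proof (rule fps_ext)
  fix n
  consider "n = 0" | "n = 1" | m where "n = Suc m" "m \<ge> 1"
    by (cases n) (auto simp: One_nat_def Suc_le_eq)
  then show "B_gf $ n = (fps_const var_t * fps_X + fps_const (var_t + var_x * var_y) * (fps_X * B_gf) + first_gf 3) $ n"
  proof cases
    case 1
    then show ?thesis by (simp add: B_gf_nth first_gf_def Av_first_0)
  next
    case 2
    then show ?thesis by (simp add: B_gf_nth first_gf_def Av_first_1 total_weight_Av_1)
  next
    case 3
    then show ?thesis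
      using total_weight_Av[of n] total_weight_first_1[of m] total_weight_first_2[of m]
      by (simp add: B_gf_nth first_gf_def distrib_right)
  qed
qed

lemma first_gf_2_eq: "first_gf 2 = fps_const (var_x * var_y) * (fps_X * B_gf)"
proof (rule fps_ext)
  fix n
  consider "n = 0" | "n = 1" | m where "n = Suc m" "m \<ge> 1"
    by (cases n) (auto simp: One_nat_def Suc_le_eq)
  then show "first_gf 2 $ n = (fps_const (var_x * var_y) * (fps_X * B_gf)) $ n"
    by cases (simp_all add: B_gf_nth first_gf_def Av_first_0 Av_first_1 total_weight_first_2)
qed

text \<open>The two-step recurrence starts at length \<open>3\<close>, so the lengths
  \<open>0\<close>, \<open>1\<close>, \<open>2\<close> are checked separately.\<close>

lemma first_gf_3_eq:
  "first_gf 3 = fps_const (var_t * var_x * var_y ^ 3) * (fps_X ^ 2 * B_gf)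
    + fps_const (var_x * var_y ^ 4) * (fps_X ^ 2 * first_gf 2)
    + fps_const (var_x ^ 2 * var_y ^ 4) * (fps_X ^ 2 * first_gf 3)" (is "_ = ?R")
proof (rule fps_ext)
  fix n
  consider "n = 0" | "n = 1" | "n = 2" | m where "n = Suc (Suc m)" "m \<ge> 1"
    by (cases n; cases "n - 1") (auto simp: One_nat_def Suc_le_eq numeral_2_eq_2)
  then show "first_gf 3 $ n = ?R $ n"
  proof cases
    case 3
    \<comment> \<open>Removing the first entry would leave a word of length \<open>1\<close> that
      starts with \<open>2\<close> or \<open>3\<close>.\<close>
    have "Av_first 3 2 = {}"
      using Av_first_3_Suc[of 1] Av_first_1 by (simp add: numeral_2_eq_2 One_nat_def)
    with 3 show ?thesis
      by (simp add: B_gf_nth first_gf_def fps_X_power_mult_nth Av_first_0)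
  next
    case 4
    then show ?thesis
      by (simp add: B_gf_nth first_gf_def fps_X_power_mult_nth total_weight_first_3)
  qed (simp_all add: B_gf_nth first_gf_def fps_X_power_mult_nth Av_first_0 Av_first_1)
qed

text \<open>\<open>B\<close>, \<open>C\<close>, \<open>D\<close> stand for \<open>B_gf\<close>,
  \<open>first_gf 2\<close>, \<open>first_gf 3\<close>. The first equation is solved for
  \<open>D\<close>, and substitution leaves a polynomial identity valid in any commutative
  ring.\<close>

lemma eliminate_first:
  fixes B C D t x y z :: "'a :: comm_ring_1"
  assumes B: "B = t * z + (t + x * y) * (z * B) + D"
    and C: "C = x * y * (z * B)"
    and D: "D = t * x * y ^ 3 * (z ^ 2 * B) + x * y ^ 4 * (z ^ 2 * C) + x ^ 2 * y ^ 4 * (z ^ 2 * D)"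
  shows "B * (1 - z * (x * y + t) - x * y^3 * z^2 * (t + x * y) - x^2 * y^4 * z^3 * (y - t - x * y)) =
    t * z * (1 - x^2 * y^4 * z^2)"
proof -
  have D': "D = B - t * z - (t + x * y) * (z * B)"
    using B by (simp add: algebra_simps)
  show ?thesis
    using D unfolding C D' by (simp add: algebra_simps power2_eq_square power3_eq_cube power4_eq_xxxx)
qed

theorem theorem9:
  shows "let t = fps_const var_t; x = fps_const var_x; y = fps_const var_y; z = fps_X in
    to_fract B_gf =
      to_fract (t * z * (1 - x^2 * y^4 * z^2)) /
      to_fract (1 - z * (x * y + t) - x * y^3 * z^2 * (t + x * y)
                  - x^2 * y^4 * z^3 * (y - t - x * y))"
proof -
  define t where "t = fps_const var_t"
  define x where "x = fps_const var_x"
  define y where "y = fps_const var_y"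
  define z :: "poly_txy fps" where "z = fps_X"
  define d where "d = 1 - z * (x * y + t) - x * y^3 * z^2 * (t + x * y) - x^2 * y^4 * z^3 * (y - t - x * y)"
  have "B_gf * d = t * z * (1 - x^2 * y^4 * z^2)"
    unfolding d_def
  proof (rule eliminate_first)
    show "B_gf = t * z + (t + x * y) * (z * B_gf) + first_gf 3"
      using B_gf_eq by (simp add: t_def x_def y_def z_def)
    show "first_gf 2 = x * y * (z * B_gf)"
      using first_gf_2_eq by (simp add: x_def y_def z_def)
    show "first_gf 3 = t * x * y ^ 3 * (z ^ 2 * B_gf) + x * y ^ 4 * (z ^ 2 * first_gf 2)
        + x ^ 2 * y ^ 4 * (z ^ 2 * first_gf 3)"
      using first_gf_3_eq by (simp add: t_def x_def y_def z_def fps_const_power)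
  qed
  then have "to_fract B_gf * to_fract d = to_fract (t * z * (1 - x^2 * y^4 * z^2))"
    by (simp only: to_fract_mult[symmetric])
  \<comment> \<open>The constant term shows that the denominator is nonzero, which permits the
    division in the fraction field.\<close>
  moreover have "d $ 0 = 1"
    by (simp add: d_def z_def fps_mult_nth_0 power2_eq_square power3_eq_cube)
  then have "to_fract d \<noteq> 0"
    by auto
  ultimately have "to_fract B_gf = to_fract (t * z * (1 - x^2 * y^4 * z^2)) / to_fract d"
    by (simp only: eq_divide_eq) simp
  then show ?thesis
    by (simp only: Let_def d_def t_def x_def y_def z_def)
qed

end
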